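(* Let $G=(V,E)$ be a finite directed graph without loops whose edge set is partitioned as $E=E_1\cup\cdots\cup E_p$ into pairwise disjoint classes (the class $E_i$ consisting of the edges aligned with the spatial direction $\hat d_i$). Fix $i$, let $\bar E_i\subseteq E_i$ be non-empty, and let $G_C=(V_C,E_C)$ be the component connectivity graph (CCG) of $G$ implied by the removal of $\bar E_i$, and suppose $G_C$ has $k\ge 2$ vertices. Then the removal of $\bar E_i$ implies a $k$–PFD of $G$ if and only if $G_C$ is a directed acyclic graph.
   Context: Component connectivity graph: for a vertex set $W\subseteq V$ such that the induced subgraph $G[W]$ is weakly connected, and a set $F\subseteq E_i$, the CCG of $G[W]$ implied by the removal of $F$ is the simple directed graph whose vertices are the weakly connected components of the graph $G[W]$ with the edges of $F$ deleted, and in which there is an edge $(C,C')$ if and only if $C\neq C'$ and there is an edge $(v,u)\in F$ with $v\in C$, $u\in C'$. (Components are identified with their vertex sets.) 2–PFD: the removal of $F$ from $G[W]$ implies a 2–PFD of $G[W]$ into $C_1,C_2$ if its CCG has exactly two vertices $C_1,C_2$ and contains exactly one of the edges $(C_1,C_2)$, $(C_2,C_1)$. (This is the paper's combinatorial characterization of a physically feasible separation of a rigid model into two parts by pulling them apart along $\pm\hat d_i$.) $k$–PFD (recursive, for $k\ge 2$): let $W$ be such that $G[W]$ is weakly connected, let $F\subseteq E_i$ be non-empty with edges in $G[W]$, and suppose the CCG $(V_F,E_F)$ of $G[W]$ implied by removing $F$ has $k\ge 2$ vertices. The removal of $F$ implies a $k$–PFD of $G[W]$ if there is a set $F^0\subseteq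 F$ whose removal implies a 2–PFD of $G[W]$ into $C_1,C_2$ such that one of the following holds: (1) $C_1\in V_F$ and $C_2\in V_F$; (2) $C_1\in V_F$ and the removal of the edges of $F\setminus F^0$ lying in $G[C_2]$ implies a $(k-1)$–PFD of $G[C_2]$; (3) $C_2\in V_F$ and the removal of the edges of $F\setminus F^0$ lying in $G[C_1]$ implies a $(k-1)$–PFD of $G[C_1]$; (4) $C_1\notin V_F$, $C_2\notin V_F$, and the removal of the edges of $F\setminus F^0$ lying in $G[C_1]$, resp. $G[C_2]$, implies a $k_1$–PFD of $G[C_1]$, resp. a $k_2$–PFD of $G[C_2]$, with $k_1+k_2=k$. The statement applies this with $W=V$ (the graph $G$ of a model is weakly connected) and $F=\bar E_i$. *)

theory Defs
  imports "Graph_Theory.Digraph_Component" "HOL-Library.Disjoint_Sets"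
begin

text \<open>
  Throughout, \<^const>\<open>connected\<close> means weakly connected and
  \<open>G \<restriction> W\<close> is the induced subgraph.  Arcs have their own type, so an arc \<open>e\<close> plays the
  role of the edge \<open>(tail G e, head G e)\<close>; parallel arcs are permitted.
\<close>

definition del_arcs :: "('a, 'b) pre_digraph \<Rightarrow> 'b set \<Rightarrow> ('a, 'b) pre_digraph" where
  "del_arcs G F = G\<lparr>arcs := arcs G - F\<rparr>"

definition weak_components :: "('a, 'b) pre_digraph \<Rightarrow> 'a set set" where
  "weak_components G = {verts H | H. pre_digraph.max_subgraph G connected H}"

definition ccg :: "('a, 'b) pre_digraph \<Rightarrow> 'a set \<Rightarrow> 'b set \<Rightarrow> 'a set pair_pre_digraph" where
  "ccg G W F =
     (let V\<^sub>F = weak_components (del_arcs (G \<restriction> W) F)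
      in \<lparr>pverts = V\<^sub>F,
          parcs = {(C, C'). C \<in> V\<^sub>F \<and> C' \<in> V\<^sub>F \<and> C \<noteq> C' \<and>
                     (\<exists>e\<in>F. tail G e \<in> C \<and> head G e \<in> C')}\<rparr>)"

definition two_pfd ::
  "('a, 'b) pre_digraph \<Rightarrow> 'a set \<Rightarrow> 'b set \<Rightarrow> 'a set \<Rightarrow> 'a set \<Rightarrow> bool" where
  "two_pfd G W F C\<^sub>1 C\<^sub>2 \<longleftrightarrow>
     C\<^sub>1 \<noteq> C\<^sub>2 \<and> pverts (ccg G W F) = {C\<^sub>1, C\<^sub>2} \<and>
     ((C\<^sub>1, C\<^sub>2) \<in> parcs (ccg G W F) \<longleftrightarrow> (C\<^sub>2, C\<^sub>1) \<notin> parcs (ccg G W F))"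

text \<open>
  \<open>k_pfd G E\<^sub>i W F k\<close>: removing \<open>F\<close>, a set of arcs of the class \<open>E\<^sub>i\<close>, implies a \<open>k\<close>-PFD of
  \<open>G \<restriction> W\<close>.
\<close>

inductive k_pfd ::
  "('a, 'b) pre_digraph \<Rightarrow> 'b set \<Rightarrow> 'a set \<Rightarrow> 'b set \<Rightarrow> nat \<Rightarrow> bool"
  for G :: "('a, 'b) pre_digraph" and E\<^sub>i :: "'b set" where
  "k_pfd G E\<^sub>i W F k"
  if "W \<subseteq> verts G" and "connected (G \<restriction> W)"
    and "F \<subseteq> E\<^sub>i" and "F \<noteq> {}" and "F \<subseteq> arcs (G \<restriction> W)"
    and "V\<^sub>F = pverts (ccg G W F)" and "card V\<^sub>F = k" and "2 \<le> k"
    and "F\<^sub>0 \<subseteq> F" and "two_pfd G W F\<^sub>0 C\<^sub>1 C\<^sub>2"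
    and "C\<^sub>1 \<in> V\<^sub>F \<and> C\<^sub>2 \<in> V\<^sub>F
       \<or> C\<^sub>1 \<in> V\<^sub>F \<and> k_pfd G E\<^sub>i C\<^sub>2 ((F - F\<^sub>0) \<inter> arcs (G \<restriction> C\<^sub>2)) (k - 1)
       \<or> C\<^sub>2 \<in> V\<^sub>F \<and> k_pfd G E\<^sub>i C\<^sub>1 ((F - F\<^sub>0) \<inter> arcs (G \<restriction> C\<^sub>1)) (k - 1)
       \<or> C\<^sub>1 \<notin> V\<^sub>F \<and> C\<^sub>2 \<notin> V\<^sub>F \<and>
         (\<exists>k\<^sub>1 k\<^sub>2. k\<^sub>1 + k\<^sub>2 = k \<and>
            k_pfd G E\<^sub>i C\<^sub>1 ((F - F\<^sub>0) \<inter> arcs (G \<restriction> C\<^sub>1)) k\<^sub>1 \<and>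
            k_pfd G E\<^sub>i C\<^sub>2 ((F - F\<^sub>0) \<inter> arcs (G \<restriction> C\<^sub>2)) k\<^sub>2)"

end

theory Submission
  imports Defs
begin

text \<open>
  The reachability-based notion of weak connectedness is replaced by cuts: a set is connected iff
  every proper nonempty part of it is joined to the rest.

  If the CCG is acyclic, it has a source \<open>S\<close>.  Let \<open>C\<close> be a weak component of the graph
  without \<open>S\<close>.  Both \<open>C\<close> and its complement are connected, and all arcs between them
  start in \<open>S\<close> and end in \<open>C\<close>, so this is a 2-PFD; each side inherits an acyclic CCG.

  Conversely, a 2-PFD orders its two sides, so a cycle of the CCG stays within one side.  The set
  \<open>F\<^sub>0\<close> may contain arcs inside a side, so the CCG of that side with respect to
  \<open>F - F\<^sub>0\<close> could be coarser than the one with respect to \<open>F\<close>; the requirement on the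
  numbers of components excludes this.
\<close>

section \<open>Connectivity by cuts\<close>

text \<open>The arc set is a parameter of its own and \<open>G\<close> supplies only
  \<open>tail\<close> and \<open>head\<close>. Deleting arcs then just shrinks \<open>A\<close>, and
  different deletions compare by inclusion.\<close>

definition joined :: "('a, 'b) pre_digraph \<Rightarrow> 'b set \<Rightarrow> 'a set \<Rightarrow> 'a set \<Rightarrow> bool" where
  "joined G A X Y \<longleftrightarrow>
     (\<exists>e\<in>A. tail G e \<in> X \<and> head G e \<in> Y \<or> tail G e \<in> Y \<and> head G e \<in> X)"

definition cut_connected :: "('a, 'b) pre_digraph \<Rightarrow> 'b set \<Rightarrow> 'a set \<Rightarrow> bool" where
  "cut_connected G A S \<longleftrightarrow> S \<noteq> {} \<and> (\<forall>X. X \<noteq> {} \<longrightarrow> X \<subset> S \<longrightarrow> joined G A X (S - X))"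

text \<open>These are the weak components of the graph on \<open>W\<close> with the arcs of
  \<open>A\<close> inside \<open>W\<close>. Maximality of the blocks is implied: a larger connected
  set would need an arc between two blocks.\<close>

definition decomposes ::
  "('a, 'b) pre_digraph \<Rightarrow> 'b set \<Rightarrow> 'a set \<Rightarrow> 'a set set \<Rightarrow> bool" where
  "decomposes G A W P \<longleftrightarrow> partition_on W P \<and> (\<forall>C\<in>P. cut_connected G A C) \<and>
     (\<forall>C\<in>P. \<forall>D\<in>P. C \<noteq> D \<longrightarrow> \<not> joined G A C D)"

lemma joined_sym: "joined G A X Y \<longleftrightarrow> joined G A Y X"
  by (auto simp: joined_def)

lemma joined_mono:
  "joined G A X Y \<Longrightarrow> A \<subseteq> B \<Longrightarrow> X \<subseteq> X' \<Longrightarrow> Y \<subseteq> Y' \<Longrightarrow> joined G B X' Y'"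
  unfolding joined_def by blast

lemma cut_connected_mono: "cut_connected G A S \<Longrightarrow> A \<subseteq> B \<Longrightarrow> cut_connected G B S"
  unfolding cut_connected_def by (metis joined_mono subset_refl)

lemma cut_connected_joined:
  assumes "cut_connected G A S" "x \<in> S" "x \<in> X" "y \<in> S" "y \<notin> X"
  shows "joined G A (S \<inter> X) (S - X)"
proof -
  have "S \<inter> X \<noteq> {}" "S \<inter> X \<subset> S" using assms by auto
  then have "joined G A (S \<inter> X) (S - S \<inter> X)" using assms(1) by (simp add: cut_connected_def)
  then show ?thesis by (simp add: Diff_Int)
qed

text \<open>A cut \<open>X\<close> of the union has points on both sides. The common point
  \<open>x\<close> is on one of them, and a member \<open>S\<close> with a point on the other is
  itself cut by \<open>X\<close>.\<close>

lemma cut_connected_Union: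
  assumes conn: "\<And>S. S \<in> \<S> \<Longrightarrow> cut_connected G A S" and "\<S> \<noteq> {}" and x: "\<And>S. S \<in> \<S> \<Longrightarrow> x \<in> S"
  shows "cut_connected G A (\<Union>\<S>)"
  unfolding cut_connected_def
proof (intro conjI allI impI)
  show "\<Union>\<S> \<noteq> {}" using assms by blast
  fix X assume X: "X \<noteq> {}" "X \<subset> \<Union>\<S>"
  obtain S u v where S: "S \<in> \<S>" and uv: "u \<in> S" "u \<in> X" "v \<in> S" "v \<notin> X"
  proof (cases "x \<in> X")
    case True
    obtain y S where "y \<in> S" "S \<in> \<S>" "y \<notin> X" using X by blast
    then show thesis using that x True by blast
  next
    case False
    obtain y S where "y \<in> S" "S \<in> \<S>" "y \<in> X" using X by blast
    then show thesis using that x False by blast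
  qed
  have "joined G A (S \<inter> X) (S - X)" using cut_connected_joined[OF conn[OF S] uv] .
  then show "joined G A X (\<Union>\<S> - X)" by (rule joined_mono) (use S in auto)
qed

text \<open>If no arc crosses a cut \<open>X\<close>, each of \<open>C\<close> and \<open>D\<close>
  lies wholly inside or outside \<open>X\<close>. Then \<open>X\<close> separates them, and the arc
  joining them crosses it after all.\<close>

lemma cut_connected_Un_joined:
  assumes C: "cut_connected G A C" and D: "cut_connected G A D" and J: "joined G A C D"
  shows "cut_connected G A (C \<union> D)"
  unfolding cut_connected_def
proof (intro conjI allI impI)
  show "C \<union> D \<noteq> {}" using C by (simp add: cut_connected_def)
  fix X assume X: "X \<noteq> {}" "X \<subset> C \<union> D"
  show "joined G A X (C \<union> D - X)"
  proof (rule ccontr)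
    assume no: "\<not> joined G A X (C \<union> D - X)"
    have "T \<subseteq> X \<or> T \<inter> X = {}" if T: "T = C \<or> T = D" for T
    proof (rule ccontr)
      assume "\<not> ?thesis"
      then obtain u v where "u \<in> T" "u \<in> X" "v \<in> T" "v \<notin> X" by blast
      then have "joined G A (T \<inter> X) (T - X)" using cut_connected_joined T C D by metis
      then have "joined G A X (C \<union> D - X)" by (rule joined_mono) (use T in auto)
      with no show False ..
    qed
    then have "C \<subseteq> X \<and> D \<inter> X = {} \<or> D \<subseteq> X \<and> C \<inter> X = {}" using X by blast
    then have "joined G A X (C \<union> D - X)"
    proof
      assume "C \<subseteq> X \<and> D \<inter> X = {}"
      then show ?thesis by (intro joined_mono[OF J]) auto
    next
      assume "D \<subseteq> X \<and> C \<inter> X = {}"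
      then show ?thesis by (intro joined_mono[OF J[unfolded joined_sym[of G A C]]]) auto
    qed
    with no show False ..
  qed
qed

section \<open>Existence and invariance of decompositions\<close>

text \<open>The block of \<open>x\<close> is the union of all connected subsets of \<open>W\<close>
  that contain \<open>x\<close>. Overlapping blocks coincide by maximality, and an arc between two
  blocks would make their union connected.\<close>

lemma ex_decomposes: "\<exists>P. decomposes G A W P"
proof -
  define K where "K x = \<Union>{S. S \<subseteq> W \<and> x \<in> S \<and> cut_connected G A S}" for x
  have max: "S \<subseteq> K x" if "S \<subseteq> W" "x \<in> S" "cut_connected G A S" for S x
    using that by (auto simp: K_def)
  have sing: "cut_connected G A {x}" for x by (auto simp: cut_connected_def)
  have conn: "cut_connected G A (K x)" if "x \<in> W" for x
    unfolding K_def by (rule cut_connected_Union[where x = x]) (use that sing in auto)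
  have KW: "K x \<subseteq> W" for x by (auto simp: K_def)
  have self: "x \<in> K x" if "x \<in> W" for x using max[of "{x}" x] sing that by auto
  have eq: "K x = K z" if "x \<in> W" "z \<in> K x" for x z
  proof
    have z: "z \<in> W" using KW that by blast
    show sub: "K x \<subseteq> K z" using max[of "K x" z] KW conn that by blast
    show "K z \<subseteq> K x" using max[of "K z" x] KW conn z sub self that by blast
  qed
  have "decomposes G A W (K ` W)"
    unfolding decomposes_def
  proof (intro conjI ballI impI)
    have "C = D" if CD: "C \<in> K ` W" "D \<in> K ` W" and z: "z \<in> C" "z \<in> D" for C D z
    proof -
      obtain x y where xy: "x \<in> W" "C = K x" "y \<in> W" "D = K y" using CD by blast
      then show ?thesis using eq[of x z] eq[of y z] z by simp
    qed
    then have "disjoint (K ` W)" unfolding disjoint_def by blast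
    moreover have "\<Union>(K ` W) = W" using KW self by blast
    moreover have "{} \<notin> K ` W" using self by blast
    ultimately show "partition_on W (K ` W)" unfolding partition_on_def by blast
    show "cut_connected G A C" if "C \<in> K ` W" for C using that conn by blast
    show "\<not> joined G A C D" if CD: "C \<in> K ` W" "D \<in> K ` W" "C \<noteq> D" for C D
    proof
      assume J: "joined G A C D"
      obtain x y where xy: "x \<in> W" "C = K x" "y \<in> W" "D = K y" using CD by blast
      have "cut_connected G A (C \<union> D)" using cut_connected_Un_joined J conn xy by blast
      then have "C \<union> D \<subseteq> K x" using max[of "C \<union> D" x] KW xy self by blast
      then have "y \<in> K x" using self xy by blast
      then show False using eq[of x y] xy CD by blast
    qed
  qed
  then show ?thesis ..
qed

text \<open>A cut of \<open>S\<close> sees only arcs with both ends in \<open>S\<close>. This moves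
  statements between \<open>G\<close> and its subgraphs.\<close>

lemma cut_connected_cong:
  assumes "tail H = tail G" "head H = head G"
    and "\<And>e. tail G e \<in> S \<Longrightarrow> head G e \<in> S \<Longrightarrow> e \<in> A \<longleftrightarrow> e \<in> B"
  shows "cut_connected H A S \<longleftrightarrow> cut_connected G B S"
proof -
  have "joined H A X (S - X) \<longleftrightarrow> joined G B X (S - X)" if "X \<subset> S" for X
    unfolding joined_def assms(1,2) using assms(3) that by blast
  then show ?thesis by (auto simp: cut_connected_def)
qed

lemma decomposes_cong:
  assumes eq: "tail H = tail G" "head H = head G"
    and AB: "\<And>e. tail G e \<in> W \<Longrightarrow> head G e \<in> W \<Longrightarrow> e \<in> A \<longleftrightarrow> e \<in> B"
  shows "decomposes H A W P \<longleftrightarrow> decomposes G B W P"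
proof -
  have "cut_connected H A C \<longleftrightarrow> cut_connected G B C" if "C \<subseteq> W" for C
    by (rule cut_connected_cong) (use that eq AB in auto)
  moreover have "joined H A C D \<longleftrightarrow> joined G B C D" if "C \<subseteq> W" "D \<subseteq> W" for C D
    using that AB unfolding joined_def eq by blast
  moreover have "C \<subseteq> W" if "partition_on W P" "C \<in> P" for C
    using that by (auto simp: partition_on_def)
  ultimately show ?thesis by (cases "partition_on W P") (simp_all add: decomposes_def)
qed

section \<open>Uniqueness, restriction and comparison of decompositions\<close>

lemma decomposes_not_joined:
  assumes P: "decomposes G A W P" and C: "C \<in> P"
  shows "\<not> joined G A C (W - C)"
proof
  assume "joined G A C (W - C)"
  moreover have "W = \<Union>P" using P by (simp add: decomposes_def partition_on_def)
  ultimately obtain D where "D \<in> P" "D \<noteq> C" "joined G A C D" unfolding joined_def by blast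
  then show False using P C unfolding decomposes_def by metis
qed

text \<open>If \<open>S\<close> left the block of one of its points, connectedness would give an arc
  out of that block. Allowing a smaller arc set \<open>B\<close> for \<open>S\<close> makes
  decompositions for different deletions comparable.\<close>

lemma decomposes_absorb:
  assumes P: "decomposes G A W P" and S: "cut_connected G B S" "B \<subseteq> A" "S \<subseteq> W"
  obtains C where "C \<in> P" "S \<subseteq> C"
proof -
  have W: "\<Union>P = W" using P by (simp add: decomposes_def partition_on_def)
  obtain x where x: "x \<in> S" using S by (auto simp: cut_connected_def)
  then obtain C where C: "C \<in> P" "x \<in> C" using W S by blast
  have "S \<subseteq> C"
  proof (rule ccontr)
    assume "\<not> S \<subseteq> C"
    then obtain y where "y \<in> S" "y \<notin> C" by blast
    then have "joined G B (S \<inter> C) (S - C)" using cut_connected_joined S(1) x C(2) by metis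
    then have "joined G A C (W - C)" by (rule joined_mono) (use S in auto)
    then show False using decomposes_not_joined[OF P C(1)] by simp
  qed
  with C that show thesis by blast
qed

lemma partition_on_mem_eq:
  "partition_on W P \<Longrightarrow> C \<in> P \<Longrightarrow> D \<in> P \<Longrightarrow> x \<in> C \<Longrightarrow> x \<in> D \<Longrightarrow> C = D"
  unfolding partition_on_def disjoint_def by blast

lemma partition_on_subset_eq:
  "partition_on W P \<Longrightarrow> C \<in> P \<Longrightarrow> D \<in> P \<Longrightarrow> C \<subseteq> D \<Longrightarrow> C = D"
  unfolding partition_on_def disjoint_def by (metis inf.absorb1)

text \<open>A block of \<open>P\<close> lies in a block of \<open>Q\<close>, which lies in turn in a
  block of \<open>P\<close>; disjointness makes all three equal.\<close>

lemma decomposes_unique: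
  assumes P: "decomposes G A W P" and Q: "decomposes G A W Q"
  shows "P = Q"
proof -
  have "P \<subseteq> Q" if P: "decomposes G A W P" and Q: "decomposes G A W Q" for P Q
  proof
    fix C assume C: "C \<in> P"
    have parts: "partition_on W P" "partition_on W Q" using P Q by (auto simp: decomposes_def)
    have "cut_connected G A C" "C \<subseteq> W" using P C by (auto simp: decomposes_def partition_on_def)
    then obtain D where D: "D \<in> Q" "C \<subseteq> D" using decomposes_absorb[OF Q] by blast
    have "cut_connected G A D" "D \<subseteq> W" using Q D by (auto simp: decomposes_def partition_on_def)
    then obtain C' where "C' \<in> P" "D \<subseteq> C'" using decomposes_absorb[OF P] by blast
    then have "C = D" using partition_on_subset_eq[OF parts(1) C] D by blast
    with D show "C \<in> Q" by simp
  qed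
  then show ?thesis using P Q by blast
qed

lemma decomposes_restrict:
  assumes P: "decomposes G A W P" and C: "C \<subseteq> W" "\<not> joined G A C (W - C)"
  shows "decomposes G A C {D \<in> P. D \<subseteq> C}" and "D \<in> P \<Longrightarrow> D \<subseteq> C \<or> D \<subseteq> W - C"
proof -
  have part: "\<Union>P = W" "disjoint P" "{} \<notin> P" using P by (auto simp: decomposes_def partition_on_def)
  show side: "D \<subseteq> C \<or> D \<subseteq> W - C" if D: "D \<in> P" for D
  proof (rule ccontr)
    assume "\<not> ?thesis"
    then obtain u v where "u \<in> D" "u \<in> C" "v \<in> D" "v \<notin> C" using D part by blast
    moreover have "cut_connected G A D" using P D by (simp add: decomposes_def)
    ultimately have "joined G A (D \<inter> C) (D - C)" using cut_connected_joined by metis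
    then have "joined G A C (W - C)" by (rule joined_mono) (use D part in auto)
    with C show False by simp
  qed
  have "C \<subseteq> \<Union>{D \<in> P. D \<subseteq> C}"
  proof
    fix x assume "x \<in> C"
    moreover from this obtain D where "D \<in> P" "x \<in> D" using part C by blast
    ultimately show "x \<in> \<Union>{D \<in> P. D \<subseteq> C}" using side by blast
  qed
  then have "partition_on C {D \<in> P. D \<subseteq> C}"
    using part unfolding partition_on_def disjoint_def by blast
  then show "decomposes G A C {D \<in> P. D \<subseteq> C}" using P by (simp add: decomposes_def)
qed

text \<open>A connected block cannot straddle an uncrossed cut. The last two conclusions let the
  numbers of components of the two sides be added.\<close>

lemma decomposes_split:
  assumes P: "decomposes G A W P" and W: "B \<union> C = W" "B \<inter> C = {}" and nj: "\<not> joined G A B C"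
  shows "decomposes G A B {D \<in> P. D \<subseteq> B}" and "decomposes G A C {D \<in> P. D \<subseteq> C}"
    and "P = {D \<in> P. D \<subseteq> B} \<union> {D \<in> P. D \<subseteq> C}" and "{D \<in> P. D \<subseteq> B} \<inter> {D \<in> P. D \<subseteq> C} = {}"
proof -
  have WB: "W - B = C" "W - C = B" using W by auto
  have njB: "\<not> joined G A B (W - B)" and njC: "\<not> joined G A C (W - C)"
    using nj joined_sym[of G A B C] by (auto simp: WB)
  show "decomposes G A B {D \<in> P. D \<subseteq> B}" using decomposes_restrict(1)[OF P _ njB] W by blast
  show "decomposes G A C {D \<in> P. D \<subseteq> C}" using decomposes_restrict(1)[OF P _ njC] W by blast
  have "D \<subseteq> B \<or> D \<subseteq> C" if "D \<in> P" for D
    using decomposes_restrict(2)[OF P _ njB that] W by (auto simp: WB)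
  then show "P = {D \<in> P. D \<subseteq> B} \<union> {D \<in> P. D \<subseteq> C}" by blast
  have "{} \<notin> P" using P by (simp add: decomposes_def partition_on_def)
  moreover have "D = {}" if "D \<subseteq> B" "D \<subseteq> C" for D using that W by blast
  ultimately show "{D \<in> P. D \<subseteq> B} \<inter> {D \<in> P. D \<subseteq> C} = {}" by blast
qed

lemma decomposes_block_eq: "decomposes G A W P \<Longrightarrow> W \<in> P \<Longrightarrow> P = {W}"
  using partition_on_subset_eq[of W P] by (auto simp: decomposes_def partition_on_def)

text \<open>\<open>C\<close> is a component of \<open>W - S\<close>. Every other component of
  \<open>W - S\<close> is attached to \<open>S\<close>, because \<open>W\<close> is connected, so
  \<open>W - C\<close> stays connected.\<close>

lemma cut_connected_split_off:
  assumes W: "cut_connected G A W" and S: "cut_connected G A S" "S \<subset> W"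
  obtains C where "C \<subseteq> W - S" "cut_connected G A C" "cut_connected G A (W - C)"
    "\<not> joined G A C (W - S - C)"
proof -
  obtain P where P: "decomposes G A (W - S) P" using ex_decomposes by blast
  then have U: "\<Union>P = W - S" by (simp add: decomposes_def partition_on_def)
  then obtain C where C: "C \<in> P" using S by fastforce
  have CW: "C \<subseteq> W - S" using U C by blast
  have nj: "\<not> joined G A C (W - S - C)" using decomposes_not_joined[OF P C] .
  have "cut_connected G A (W - C)"
    unfolding cut_connected_def
  proof (intro conjI allI impI)
    show "W - C \<noteq> {}" using S CW by (auto simp: cut_connected_def)
    fix X assume X: "X \<noteq> {}" "X \<subset> W - C"
    show "joined G A X (W - C - X)"
    proof (rule ccontr)
      assume no: "\<not> joined G A X (W - C - X)"
      \<comment> \<open>A set \<open>Y\<close> that avoids \<open>S\<close> and \<open>C\<close> is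
        not joined to \<open>C\<close>, a component of \<open>W - S\<close>. If it were also
        isolated in \<open>W - C\<close>, it would be cut off in all of \<open>W\<close>.\<close>
      have False if Y: "Y \<noteq> {}" "Y \<subseteq> W - C - S" "\<not> joined G A Y (W - C - Y)" for Y
      proof -
        have "Y \<subset> W" using Y S by (auto simp: cut_connected_def)
        then have "joined G A Y (W - Y)" using W Y(1) by (simp add: cut_connected_def)
        then have "joined G A Y (W - C - Y) \<or> joined G A C Y"
          unfolding joined_def by blast
        moreover have "\<not> joined G A C Y" using nj joined_mono[of G A C Y A C "W - S - C"] Y(2) by blast
        ultimately show False using Y(3) by blast
      qed
      note no_Y = this
      \<comment> \<open>Being connected, \<open>S\<close> lies on one side of the uncrossed cut
        \<open>X\<close>; the other side serves as \<open>Y\<close>.\<close>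
      show False
      proof (cases "S \<inter> X = {}")
        case True
        then show False using no_Y[of X] X no by blast
      next
        case False
        have "S \<subseteq> X"
        proof (rule ccontr)
          assume "\<not> S \<subseteq> X"
          with False obtain u v where "u \<in> S" "u \<in> X" "v \<in> S" "v \<notin> X" by blast
          then have "joined G A (S \<inter> X) (S - X)" using cut_connected_joined S(1) by metis
          then have "joined G A X (W - C - X)" by (rule joined_mono) (use S CW in auto)
          with no show False ..
        qed
        moreover have "W - C - (W - C - X) = X" using X by blast
        ultimately show False
          using no_Y[of "W - C - X"] X no joined_sym[of G A X "W - C - X"] by auto
      qed
    qed
  qed
  moreover have "cut_connected G A C" using P C by (simp add: decomposes_def)
  ultimately show thesis using that CW nj by blast
qed

text \<open>Extra arcs only merge blocks, so sending a block of \<open>P\<close> to the block of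
  \<open>Q\<close> around it is a surjection. With equal cardinalities it is injective, and then no
  block of \<open>Q\<close> contains two blocks of \<open>P\<close>.\<close>

lemma decomposes_coarser:
  assumes P: "decomposes G A W P" and Q: "decomposes G B W Q" and AB: "A \<subseteq> B" and fin: "finite P"
  shows "card Q \<le> card P" and "card Q = card P \<Longrightarrow> Q = P"
proof -
  have parts: "partition_on W P" "partition_on W Q" using P Q by (auto simp: decomposes_def)
  have "\<exists>E\<in>Q. D \<subseteq> E" if "D \<in> P" for D
  proof -
    have "cut_connected G A D" "D \<subseteq> W" using P that by (auto simp: decomposes_def partition_on_def)
    then show ?thesis using decomposes_absorb[OF Q _ AB] by blast
  qed
  then obtain f where f: "\<And>D. D \<in> P \<Longrightarrow> f D \<in> Q" "\<And>D. D \<in> P \<Longrightarrow> D \<subseteq> f D" by metis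
  have f_eq: "f D = E" if "D \<in> P" "E \<in> Q" "x \<in> D" "x \<in> E" for D E x
    using partition_on_mem_eq[OF parts(2) f(1)] f(2) that by blast
  have surj: "f ` P = Q"
  proof
    show "f ` P \<subseteq> Q" using f by blast
    show "Q \<subseteq> f ` P"
    proof
      fix E assume E: "E \<in> Q"
      then obtain x where x: "x \<in> E" "x \<in> W" using parts(2) unfolding partition_on_def
        by (metis UnionI ex_in_conv)
      then obtain D where "D \<in> P" "x \<in> D" using parts(1) unfolding partition_on_def by blast
      then show "E \<in> f ` P" using f_eq[of _ E x] x E by blast
    qed
  qed
  then show "card Q \<le> card P" using card_image_le[OF fin] by blast
  assume "card Q = card P"
  then have inj: "inj_on f P" using surj fin by (simp add: eq_card_imp_inj_on)
  have "f D = D" if D: "D \<in> P" for D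
  proof
    show "D \<subseteq> f D" using f D by blast
    show "f D \<subseteq> D"
    proof
      fix x assume x: "x \<in> f D"
      then have "x \<in> W" using f D parts(2) unfolding partition_on_def by blast
      then obtain D' where D': "D' \<in> P" "x \<in> D'" using parts(1) unfolding partition_on_def by blast
      then have "f D' = f D" using f_eq[of D' "f D" x] x f(1) D by blast
      then show "x \<in> D" using inj D D' by (auto dest: inj_onD)
    qed
  qed
  then show "Q = P" using surj by auto
qed

section \<open>Weak components and the CCG\<close>

text \<open>Forwards, a path from inside a cut to outside must cross it. Backwards, the set of
  vertices reachable from \<open>u\<close>, if proper, would be a cut, and an arc crossing it would
  lead to a further reachable vertex.\<close>

lemma connected_iff_cut_connected: "connected G \<longleftrightarrow> cut_connected G (arcs G) (verts G)"
proof
  let ?R = "rtrancl_on (verts G) ((arcs_ends G)\<^sup>s)"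
  {
    assume conn: "connected G"
    show "cut_connected G (arcs G) (verts G)"
      unfolding cut_connected_def
    proof (intro conjI allI impI)
      show "verts G \<noteq> {}" using conn by (simp add: connected_conv)
      fix X assume X: "X \<noteq> {}" "X \<subset> verts G"
      show "joined G (arcs G) X (verts G - X)"
      proof (rule ccontr)
        assume no: "\<not> joined G (arcs G) X (verts G - X)"
        obtain u v where uv: "u \<in> X" "u \<in> verts G" "v \<in> verts G" "v \<notin> X" using X by blast
        then have "(u, v) \<in> ?R" using conn by (simp add: connected_conv)
        then have "v \<in> X"
        proof (induct rule: rtrancl_on_induct)
          case base
          show ?case using uv by simp
        next
          case (step y z)
          then show ?case using no by (auto simp: joined_def symcl_def arcs_ends_conv)
        qed
        then show False using uv by simp
      qed
    qed
  next
    assume cut: "cut_connected G (arcs G) (verts G)"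
    show "connected G"
      unfolding connected_conv
    proof (intro conjI ballI)
      show "verts G \<noteq> {}" using cut by (simp add: cut_connected_def)
      fix u v assume uv: "u \<in> verts G" "v \<in> verts G"
      show "(u, v) \<in> ?R"
      proof (rule ccontr)
        assume "(u, v) \<notin> ?R"
        then have "joined G (arcs G) (verts G \<inter> {w. (u, w) \<in> ?R}) (verts G - {w. (u, w) \<in> ?R})"
          using cut_connected_joined[OF cut, of u _ v] uv by simp
        moreover have "(tail G e, head G e) \<in> (arcs_ends G)\<^sup>s" "(head G e, tail G e) \<in> (arcs_ends G)\<^sup>s"
          if "e \<in> arcs G" for e using that by (auto simp: symcl_def arcs_ends_conv)
        ultimately obtain a b
          where "(u, a) \<in> ?R" "(a, b) \<in> (arcs_ends G)\<^sup>s" "b \<in> verts G" "(u, b) \<notin> ?R"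
          unfolding joined_def by blast
        then show False using rtrancl_on_into_rtrancl_on by metis
      qed
    qed
  }
qed

lemma connected_induce_iff: "connected (G \<restriction> W) \<longleftrightarrow> cut_connected G (arcs G) W"
  unfolding connected_iff_cut_connected by (simp, rule cut_connected_cong) auto

text \<open>Some decomposition \<open>P\<close> exists, and it is identified with the vertex sets of
  the maximal connected subgraphs: every connected subgraph has its vertices in one block, and the
  subgraph induced by a block is connected.\<close>

lemma decomposes_weak_components:
  assumes wf: "wf_digraph H"
  shows "decomposes H (arcs H) (verts H) (weak_components H)"
proof -
  interpret wf_digraph H by (rule wf)
  obtain P where P: "decomposes H (arcs H) (verts H) P" using ex_decomposes by blast
  then have part: "partition_on (verts H) P" by (simp add: decomposes_def)
  have comp: "connected (H \<restriction> C)" "subgraph (H \<restriction> C) H" if "C \<in> P" for C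
  proof -
    show "connected (H \<restriction> C)" using P that by (simp add: connected_induce_iff decomposes_def)
    show "subgraph (H \<restriction> C) H"
      using part that by (intro subgraph_induce_subgraphI) (auto simp: partition_on_def)
  qed
  have absorb: "\<exists>C\<in>P. verts K \<subseteq> C" if K: "subgraph K H" "connected K" for K
  proof -
    have K': "tail K = tail H" "head K = head H" "arcs K \<subseteq> arcs H" "verts K \<subseteq> verts H"
      using K by (auto simp: subgraph_def compatible_def)
    have "cut_connected K (arcs K) (verts K)" using K by (simp add: connected_iff_cut_connected)
    then have "cut_connected H (arcs K) (verts K)" using cut_connected_cong K' by metis
    then show ?thesis using decomposes_absorb[OF P] K' by metis
  qed
  have sub_ind: "subgraph K (H \<restriction> C)" if K: "subgraph K H" "verts K \<subseteq> C" for K C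
    using K wellformed_induce_subgraph wf_digraph.wellformed[of K]
    by (auto simp: subgraph_def compatible_def)
  have "weak_components H = P"
  proof
    show "weak_components H \<subseteq> P"
    proof
      fix C assume "C \<in> weak_components H"
      then obtain K where K: "max_subgraph connected K" "C = verts K"
        by (auto simp: weak_components_def)
      then have K': "subgraph K H" "connected K" by (auto simp: max_subgraph_def)
      then obtain D where D: "D \<in> P" "verts K \<subseteq> D" using absorb by blast
      then have "H \<restriction> D = K" using K sub_ind[OF K'(1)] comp by (auto simp: max_subgraph_def)
      then show "C \<in> P" using D K by (metis induce_subgraph_verts)
    qed
    show "P \<subseteq> weak_components H"
    proof
      fix C assume C: "C \<in> P"
      have "max_subgraph connected (H \<restriction> C)"
        unfolding max_subgraph_def
      proof (intro conjI allI impI notI)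
        show "connected (H \<restriction> C)" "subgraph (H \<restriction> C) H" using comp C by auto
        fix K assume K: "K \<noteq> H \<restriction> C \<and> subgraph (H \<restriction> C) K" and K': "subgraph K H \<and> connected K"
        obtain D where D: "D \<in> P" "verts K \<subseteq> D" using absorb K' by blast
        have "C \<subseteq> verts K" using K by (auto simp: subgraph_def)
        then have v: "verts K = C" using partition_on_subset_eq[OF part C D(1)] D by blast
        then have "subgraph K (H \<restriction> C)" using sub_ind K' by simp
        then have "K = H \<restriction> C" using K v
          by (intro pre_digraph.equality) (auto simp: subgraph_def compatible_def)
        with K show False by simp
      qed
      then show "C \<in> weak_components H"
        unfolding weak_components_def by (metis (mono_tags, lifting) induce_subgraph_verts mem_Collect_eq)
    qed
  qed
  with P show ?thesis by simp
qed

text \<open>Arcs with an end outside \<open>W\<close> do not affect a decomposition of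
  \<open>W\<close>, so the components of the induced subgraph can be described with the arcs of the
  whole of \<open>G\<close>.\<close>

lemma (in wf_digraph) decomposes_ccg: "decomposes G (arcs G - F) W (pverts (ccg G W F))"
proof -
  let ?H = "del_arcs (G \<restriction> W) F"
  have H: "verts ?H = W" "tail ?H = tail G" "head ?H = head G"
    "arcs ?H = {e \<in> arcs G. tail G e \<in> W \<and> head G e \<in> W} - F" by (auto simp: del_arcs_def)
  have "wf_digraph ?H" by unfold_locales (auto simp: H)
  then have "decomposes ?H (arcs ?H) W (weak_components ?H)"
    using decomposes_weak_components H(1) by metis
  moreover have "decomposes ?H (arcs ?H) W P \<longleftrightarrow> decomposes G (arcs G - F) W P" for P
    by (rule decomposes_cong) (auto simp: H)
  ultimately have "decomposes G (arcs G - F) W (weak_components ?H)" by simp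
  then show ?thesis by (simp add: ccg_def Let_def)
qed

lemma in_parcs_ccg:
  "(C, D) \<in> parcs (ccg G W F) \<longleftrightarrow> C \<in> pverts (ccg G W F) \<and> D \<in> pverts (ccg G W F) \<and> C \<noteq> D \<and>
     (\<exists>e\<in>F. tail G e \<in> C \<and> head G e \<in> D)"
  by (simp add: ccg_def Let_def)

lemma (in wf_digraph) pverts_ccg_eqI: "decomposes G (arcs G - F) W P \<Longrightarrow> pverts (ccg G W F) = P"
  using decomposes_unique decomposes_ccg by metis

lemma (in fin_digraph) finite_pverts_ccg:
  assumes "W \<subseteq> verts G"
  shows "finite (pverts (ccg G W F))"
proof -
  have "partition_on W (pverts (ccg G W F))" using decomposes_ccg by (simp add: decomposes_def)
  then have "pverts (ccg G W F) \<subseteq> Pow W" by (auto simp: partition_on_def)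
  moreover have "finite W" using assms finite_verts finite_subset by blast
  ultimately show ?thesis using finite_subset by blast
qed

section \<open>The equivalence\<close>

text \<open>On finite sets acyclicity is well-foundedness. All edges between the two parts run from
  \<open>P\<close> to \<open>Q\<close>, so the domain of \<open>R\<close> misses the range of the
  rest, and the domain of \<open>P \<times> Q\<close> misses the range of \<open>S\<close>.\<close>

lemma acyclic_Un_Times:
  assumes "R \<subseteq> P \<times> P" "S \<subseteq> Q \<times> Q" "P \<inter> Q = {}" "finite P" "finite Q" "acyclic R" "acyclic S"
  shows "acyclic (R \<union> (P \<times> Q \<union> S))"
proof -
  have "wf R" "wf S"
    using assms by (auto intro!: finite_acyclic_wf intro: finite_subset[OF _ finite_cartesian_product])
  moreover have "wf (P \<times> Q)" by (rule wf_no_loop) (use assms in auto)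
  ultimately have "wf (R \<union> (P \<times> Q \<union> S))"
    using assms by (intro wf_Un) auto
  then show ?thesis by (rule wf_acyclic)
qed

text \<open>By rule induction. The CCG falls into the parts over the two sides of the 2-PFD; each
  part is a single vertex or is acyclic by induction, and the edges between them all run one
  way.\<close>

lemma (in fin_digraph) k_pfd_imp_acyclic:
  assumes "k_pfd G E W F k"
  shows "acyclic (parcs (ccg G W F))"
  using assms
proof (induction rule: k_pfd.induct)
  case (1 W F V\<^sub>F k F\<^sub>0 C\<^sub>1 C\<^sub>2)
  let ?R = "parcs (ccg G W F)"
  define side where "side C = {D \<in> V\<^sub>F. D \<subseteq> C}" for C
  define F' where "F' C = (F - F\<^sub>0) \<inter> arcs (G \<restriction> C)" for C
  have V: "pverts (ccg G W F) = V\<^sub>F" using "1.hyps" by simp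
  have FG: "F \<subseteq> arcs G" using "1.hyps" by auto
  have dec: "decomposes G (arcs G - F) W V\<^sub>F" using decomposes_ccg[of F W] V by simp
  have fin: "finite V\<^sub>F" using finite_pverts_ccg "1.hyps" V by blast
  have two: "two_pfd G W F\<^sub>0 C\<^sub>1 C\<^sub>2" by fact
  then have dec0: "decomposes G (arcs G - F\<^sub>0) W {C\<^sub>1, C\<^sub>2}" and ne: "C\<^sub>1 \<noteq> C\<^sub>2"
    using decomposes_ccg[of F\<^sub>0 W] by (auto simp: two_pfd_def)
  then have W: "C\<^sub>1 \<union> C\<^sub>2 = W" "C\<^sub>1 \<inter> C\<^sub>2 = {}" and nj0: "\<not> joined G (arcs G - F\<^sub>0) C\<^sub>1 C\<^sub>2"
    by (auto simp: decomposes_def partition_on_def disjoint_def)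
  have "\<not> joined G (arcs G - F) C\<^sub>1 C\<^sub>2"
    using nj0 joined_mono[of G "arcs G - F" C\<^sub>1 C\<^sub>2 "arcs G - F\<^sub>0" C\<^sub>1 C\<^sub>2] \<open>F\<^sub>0 \<subseteq> F\<close> by blast
  note split = decomposes_split[OF dec W this, folded side_def]
  have fin_side: "finite (side C)" for C using fin by (simp add: side_def)
  have card: "card (side C\<^sub>1) + card (side C\<^sub>2) = k"
    using card_Un_disjoint[OF fin_side fin_side split(4)] split(3) "1.hyps" by simp
  \<comment> \<open>The recursion on \<open>C\<close> removes only \<open>F' C\<close>; arcs of
    \<open>F\<^sub>0\<close> inside \<open>C\<close> stay and may merge components.\<close>
  have coarser: "arcs G - F \<subseteq> arcs G - F' C" for C by (auto simp: F'_def)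
  have le: "card (pverts (ccg G C (F' C))) \<le> card (side C)"
    and eq: "card (pverts (ccg G C (F' C))) = card (side C) \<Longrightarrow> pverts (ccg G C (F' C)) = side C"
    if "C = C\<^sub>1 \<or> C = C\<^sub>2" for C
    using decomposes_coarser[OF _ decomposes_ccg coarser fin_side] split that by blast+
  have single: "side C = {C}" if "C = C\<^sub>1 \<or> C = C\<^sub>2" "C \<in> V\<^sub>F" for C
  proof -
    have "decomposes G (arcs G - F) C (side C)" using split that by blast
    moreover have "C \<in> side C" using that by (simp add: side_def)
    ultimately show ?thesis by (rule decomposes_block_eq)
  qed
  have pfd_card: "card (pverts (ccg G C (F' C))) = n" if "k_pfd G E C (F' C) n" for C n
    using that by (cases rule: k_pfd.cases) simp
  \<comment> \<open>Neither side can have more components than its \<open>side\<close>, a side in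
    \<open>V\<^sub>F\<close> counts for one, and both ways of counting add up to \<open>k\<close>.
    Hence the counts agree on each side and nothing has merged.\<close>
  have cases: "C \<in> V\<^sub>F \<or> acyclic (parcs (ccg G C (F' C))) \<and> card (pverts (ccg G C (F' C))) = card (side C)"
    if C: "C = C\<^sub>1 \<or> C = C\<^sub>2" for C
  proof -
    have sing1: "C\<^sub>1 \<in> V\<^sub>F \<Longrightarrow> card (side C\<^sub>1) = 1" and sing2: "C\<^sub>2 \<in> V\<^sub>F \<Longrightarrow> card (side C\<^sub>2) = 1"
      using single by auto
    consider (both) "C\<^sub>1 \<in> V\<^sub>F" "C\<^sub>2 \<in> V\<^sub>F"
      | (left) "C\<^sub>1 \<in> V\<^sub>F" "k_pfd G E C\<^sub>2 (F' C\<^sub>2) (k - 1)" "acyclic (parcs (ccg G C\<^sub>2 (F' C\<^sub>2)))"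
      | (right) "C\<^sub>2 \<in> V\<^sub>F" "k_pfd G E C\<^sub>1 (F' C\<^sub>1) (k - 1)" "acyclic (parcs (ccg G C\<^sub>1 (F' C\<^sub>1)))"
      | (none) k\<^sub>1 k\<^sub>2 where "k\<^sub>1 + k\<^sub>2 = k"
          "k_pfd G E C\<^sub>1 (F' C\<^sub>1) k\<^sub>1" "acyclic (parcs (ccg G C\<^sub>1 (F' C\<^sub>1)))"
          "k_pfd G E C\<^sub>2 (F' C\<^sub>2) k\<^sub>2" "acyclic (parcs (ccg G C\<^sub>2 (F' C\<^sub>2)))"
      using "1.IH" unfolding F'_def by blast
    then show ?thesis
    proof cases
      case both
      then show ?thesis using C by blast
    next
      case left
      then show ?thesis using C pfd_card[OF left(2)] sing1 card by auto
    next
      case right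
      then show ?thesis using C pfd_card[OF right(2)] sing2 card by auto
    next
      case none
      then show ?thesis
        using C pfd_card[OF none(2)] pfd_card[OF none(4)] le[of C\<^sub>1] le[of C\<^sub>2] card by auto
    qed
  qed
  have acyc: "acyclic (?R \<inter> side C \<times> side C)" if C: "C = C\<^sub>1 \<or> C = C\<^sub>2" for C
  proof (cases "C \<in> V\<^sub>F")
    case True
    then have "?R \<inter> side C \<times> side C = {}" using single[OF C] by (auto simp: in_parcs_ccg)
    then show ?thesis by (simp add: acyclic_def)
  next
    case False
    then have ac: "acyclic (parcs (ccg G C (F' C)))" and Q: "pverts (ccg G C (F' C)) = side C"
      using cases[OF C] eq[OF C] by auto
    \<comment> \<open>An arc of \<open>F\<close> between different components inside
      \<open>C\<close> must lie in \<open>F' C\<close>; otherwise it would join two blocks that stay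
      separate when only \<open>F' C\<close> is removed.\<close>
    have "?R \<inter> side C \<times> side C \<subseteq> parcs (ccg G C (F' C))"
    proof (rule subrelI)
      fix D D' assume DD': "(D, D') \<in> ?R \<inter> side C \<times> side C"
      then obtain e where e: "e \<in> F" "tail G e \<in> D" "head G e \<in> D'" "D \<noteq> D'"
        by (auto simp: in_parcs_ccg)
      have "\<not> joined G (arcs G - F' C) D D'"
        using decomposes_ccg[of "F' C" C] Q DD' e(4) by (auto simp: decomposes_def)
      then have "e \<in> F' C" using e FG by (auto simp: joined_def)
      then show "(D, D') \<in> parcs (ccg G C (F' C))" using e DD' Q by (auto simp: in_parcs_ccg)
    qed
    then show ?thesis using ac acyclic_subset by blast
  qed
  \<comment> \<open>Leaving the order of \<open>A\<close> and \<open>B\<close> open covers both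
    directions of the 2-PFD.\<close>
  have oriented: "acyclic ?R"
    if AB: "A = C\<^sub>1 \<and> B = C\<^sub>2 \<or> A = C\<^sub>2 \<and> B = C\<^sub>1" and no: "(B, A) \<notin> parcs (ccg G W F\<^sub>0)" for A B
  proof -
    have "?R \<subseteq> ?R \<inter> side A \<times> side A \<union> (side A \<times> side B \<union> ?R \<inter> side B \<times> side B)"
    proof (rule subrelI)
      fix D D' assume DD': "(D, D') \<in> ?R"
      then have mem: "D \<in> side A \<union> side B" "D' \<in> side A \<union> side B"
        using split(3) AB V by (auto simp: in_parcs_ccg)
      \<comment> \<open>All arcs between the two sides belong to \<open>F\<^sub>0\<close>, so an
        edge of \<open>?R\<close> against the order would yield the excluded edge from
        \<open>B\<close> to \<open>A\<close>.\<close>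
      have "\<not> (D \<in> side B \<and> D' \<in> side A)"
      proof
        assume "D \<in> side B \<and> D' \<in> side A"
        then obtain e where e: "e \<in> F" "tail G e \<in> B" "head G e \<in> A"
          using DD' by (auto simp: in_parcs_ccg side_def)
        then have "e \<in> F\<^sub>0" using nj0 AB FG by (auto simp: joined_def)
        then have "(B, A) \<in> parcs (ccg G W F\<^sub>0)"
          using e AB ne two by (auto simp: in_parcs_ccg two_pfd_def)
        with no show False ..
      qed
      then show "(D, D') \<in> ?R \<inter> side A \<times> side A \<union> (side A \<times> side B \<union> ?R \<inter> side B \<times> side B)"
        using mem DD' by blast
    qed
    moreover have "acyclic (?R \<inter> side A \<times> side A \<union> (side A \<times> side B \<union> ?R \<inter> side B \<times> side B))"
      by (rule acyclic_Un_Times) (use AB acyc fin_side split(4) in auto)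
    ultimately show ?thesis using acyclic_subset by blast
  qed
  show ?case using two oriented unfolding two_pfd_def by blast
qed

section \<open>From an acyclic CCG to a k-PFD\<close>

text \<open>Strong induction on \<open>k\<close>: a source of the CCG supplies a 2-PFD, and the CCG
  of each side is part of the given one and has fewer vertices.\<close>

lemma (in fin_digraph) acyclic_imp_k_pfd:
  assumes "W \<subseteq> verts G" "cut_connected G (arcs G) W" "F \<subseteq> E" "F \<subseteq> arcs (G \<restriction> W)"
    and "card (pverts (ccg G W F)) = k" "2 \<le> k" "acyclic (parcs (ccg G W F))"
  shows "k_pfd G E W F k"
  using assms
proof (induction k arbitrary: W F rule: less_induct)
  case (less k)
  let ?R = "parcs (ccg G W F)"
  define P where "P = pverts (ccg G W F)"
  have dec: "decomposes G (arcs G - F) W P" using decomposes_ccg by (simp add: P_def)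
  then have U: "\<Union>P = W" by (simp add: decomposes_def partition_on_def)
  have fin: "finite P" using finite_pverts_ccg less.prems by (simp add: P_def)
  have k: "card P = k" using less.prems by (simp add: P_def)
  have "?R \<subseteq> P \<times> P" by (auto simp: in_parcs_ccg P_def)
  then have "finite ?R" using fin finite_subset by blast
  then have "wf ?R" using less.prems finite_acyclic_wf by blast
  moreover have "P \<noteq> {}" using k less.prems by auto
  \<comment> \<open>A minimal element of the well-founded relation \<open>?R\<close> is a source of
    the CCG.\<close>
  ultimately obtain S where S: "S \<in> P" and src: "\<And>D. (D, S) \<in> ?R \<Longrightarrow> D \<notin> P"
    using wfE_min[of ?R _ P] by blast
  have W_notin: "W \<notin> P" using decomposes_block_eq[OF dec] k less.prems by auto
  then have SW: "S \<subset> W" using S U by blast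
  have S_conn: "cut_connected G (arcs G) S"
    using dec S cut_connected_mono[of G "arcs G - F" S "arcs G"] by (auto simp: decomposes_def)
  \<comment> \<open>The component is taken with all arcs present, so \<open>C\<close> and its
    complement may each consist of several vertices of the CCG.\<close>
  obtain C where C: "C \<subseteq> W - S" "cut_connected G (arcs G) C" "cut_connected G (arcs G) (W - C)"
    and nj: "\<not> joined G (arcs G) C (W - S - C)"
    using cut_connected_split_off[OF less.prems(2) S_conn SW] by blast
  define B where "B = W - C"
  have BC: "B \<union> C = W" "B \<inter> C = {}" using C by (auto simp: B_def)
  have nonempty: "B \<noteq> {}" "C \<noteq> {}" using C by (auto simp: cut_connected_def B_def)
  then have ne: "B \<noteq> C" using BC by blast
  have njS: "\<not> joined G (arcs G - F) S (W - S)" using decomposes_not_joined[OF dec S] .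
  have cross: "e \<in> F \<and> tail G e \<in> B \<and> head G e \<in> C"
    if e: "e \<in> arcs G" "tail G e \<in> B \<and> head G e \<in> C \<or> tail G e \<in> C \<and> head G e \<in> B" for e
  proof -
    \<comment> \<open>\<open>C\<close> is a component of \<open>W - S\<close>, so a crossing arc
      touches \<open>S\<close>. It leads out of or into the component \<open>S\<close>, hence lies
      in \<open>F\<close>, and a source has no incoming edge.\<close>
    have inS: "tail G e \<in> S \<and> head G e \<in> C \<or> tail G e \<in> C \<and> head G e \<in> S"
      using nj e unfolding joined_def B_def by blast
    then have eF: "e \<in> F" using njS e(1) C(1) unfolding joined_def by blast
    moreover have "\<not> (tail G e \<in> C \<and> head G e \<in> S)"
    proof
      assume a: "tail G e \<in> C \<and> head G e \<in> S"
      then obtain D where D: "D \<in> P" "tail G e \<in> D" using U C(1) by blast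
      moreover have "D \<noteq> S" using D a C(1) by blast
      ultimately have "(D, S) \<in> ?R" using a eF S by (auto simp: in_parcs_ccg P_def)
      then show False using src D by blast
    qed
    moreover have "S \<subseteq> B" using C(1) SW by (auto simp: B_def)
    ultimately show ?thesis using inS by blast
  qed
  \<comment> \<open>Taking the crossing arcs alone keeps both sides connected.\<close>
  define F\<^sub>0 where "F\<^sub>0 = {e \<in> F. tail G e \<in> B \<and> head G e \<in> C}"
  have conn: "cut_connected G (arcs G) X" "X \<subseteq> W" if "X = B \<or> X = C" for X
    using that C BC by (auto simp: B_def)
  have inside: "e \<notin> F\<^sub>0" if "X = B \<or> X = C" "tail G e \<in> X" "head G e \<in> X" for X e
    using that BC by (auto simp: F\<^sub>0_def)
  have "cut_connected G (arcs G - F\<^sub>0) X" if X: "X = B \<or> X = C" for X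
  proof -
    have "cut_connected G (arcs G - F\<^sub>0) X \<longleftrightarrow> cut_connected G (arcs G) X"
      by (rule cut_connected_cong) (use inside[OF X] in auto)
    then show ?thesis using conn[OF X] by simp
  qed
  moreover have "\<not> joined G (arcs G - F\<^sub>0) B C" using cross by (auto simp: joined_def F\<^sub>0_def)
  moreover have "partition_on W {B, C}" using BC nonempty by (auto simp: partition_on_def disjoint_def)
  ultimately have "decomposes G (arcs G - F\<^sub>0) W {B, C}"
    using joined_sym[of G "arcs G - F\<^sub>0" B C] by (auto simp: decomposes_def)
  then have V0: "pverts (ccg G W F\<^sub>0) = {B, C}" by (rule pverts_ccg_eqI)
  \<comment> \<open>Connectedness of \<open>W\<close> supplies a crossing arc, so the edge from
    \<open>B\<close> to \<open>C\<close> is really present.\<close>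
  have "joined G (arcs G) B C"
  proof -
    have "B \<subset> W" "W - B = C" using BC nonempty by auto
    then show ?thesis using less.prems(2) nonempty unfolding cut_connected_def by metis
  qed
  then obtain e where e: "e \<in> arcs G" "tail G e \<in> B \<and> head G e \<in> C \<or> tail G e \<in> C \<and> head G e \<in> B"
    by (auto simp: joined_def)
  then have "e \<in> F\<^sub>0" "tail G e \<in> B" "head G e \<in> C" using cross[OF e] by (auto simp: F\<^sub>0_def)
  then have "(B, C) \<in> parcs (ccg G W F\<^sub>0)" using V0 ne by (auto simp: in_parcs_ccg)
  moreover have "(C, B) \<notin> parcs (ccg G W F\<^sub>0)" using BC by (auto simp: in_parcs_ccg F\<^sub>0_def)
  ultimately have two: "two_pfd G W F\<^sub>0 B C" using V0 ne by (simp add: two_pfd_def)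
  define side where "side X = {D \<in> P. D \<subseteq> X}" for X
  have "\<not> joined G (arcs G - F) B C" using cross by (auto simp: joined_def)
  note split = decomposes_split[OF dec BC this, folded side_def]
  have fin_side: "finite (side X)" for X using fin by (simp add: side_def)
  have card: "card (side B) + card (side C) = k"
    using card_Un_disjoint[OF fin_side fin_side split(4)] split(3) k by simp
  have pos: "card (side X) > 0" if "X = B \<or> X = C" for X
  proof -
    have "\<Union>(side X) = X" using split that by (auto simp: decomposes_def partition_on_def)
    then have "side X \<noteq> {}" using nonempty that by auto
    then show ?thesis using fin_side by (simp add: card_gt_0_iff)
  qed
  have rec: "X \<in> P \<and> card (side X) = 1 \<or>
      X \<notin> P \<and> k_pfd G E X ((F - F\<^sub>0) \<inter> arcs (G \<restriction> X)) (card (side X))"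
    if X: "X = B \<or> X = C" for X
  proof -
    let ?F = "(F - F\<^sub>0) \<inter> arcs (G \<restriction> X)"
    have decX: "decomposes G (arcs G - F) X (side X)" using split X by blast
    \<comment> \<open>Inside \<open>X\<close> the sets \<open>?F\<close> and \<open>F\<close> agree,
      so the components of the side are exactly the vertices of the CCG in \<open>X\<close>.\<close>
    have "decomposes G (arcs G - ?F) X (side X) \<longleftrightarrow> decomposes G (arcs G - F) X (side X)"
      by (rule decomposes_cong) (use inside[OF X] in auto)
    then have VX: "pverts (ccg G X ?F) = side X" using decX pverts_ccg_eqI by blast
    then have "parcs (ccg G X ?F) \<subseteq> ?R" by (auto simp: in_parcs_ccg side_def P_def)
    then have ac: "acyclic (parcs (ccg G X ?F))" using less.prems acyclic_subset by blast
    show ?thesis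
    proof (cases "card (side X) = 1")
      case True
      then obtain D where "side X = {D}" by (auto simp: card_1_singleton_iff)
      moreover from this have "D = X" using decX by (auto simp: decomposes_def partition_on_def)
      ultimately show ?thesis using True by (auto simp: side_def)
    next
      case False
      then have "card (side X) < k" "2 \<le> card (side X)" using X pos[of B] pos[of C] card by auto
      then have "k_pfd G E X ?F (card (side X))"
        using less.IH[of "card (side X)" X ?F] conn[OF X] less.prems VX ac by auto
      moreover have "X \<notin> P"
        using decomposes_block_eq[OF decX] False by (auto simp: side_def)
      ultimately show ?thesis by blast
    qed
  qed
  \<comment> \<open>The rule asks for a nonempty \<open>F\<close>; the crossing arc \<open>e\<close>
    lies in it.\<close>
  have "F \<noteq> {}" using \<open>e \<in> F\<^sub>0\<close> by (auto simp: F\<^sub>0_def)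
  moreover have "F\<^sub>0 \<subseteq> F" by (auto simp: F\<^sub>0_def)
  moreover have "connected (G \<restriction> W)" using less.prems by (simp add: connected_induce_iff)
  moreover have "B \<in> P \<and> C \<in> P
       \<or> B \<in> P \<and> k_pfd G E C ((F - F\<^sub>0) \<inter> arcs (G \<restriction> C)) (k - 1)
       \<or> C \<in> P \<and> k_pfd G E B ((F - F\<^sub>0) \<inter> arcs (G \<restriction> B)) (k - 1)
       \<or> B \<notin> P \<and> C \<notin> P \<and>
         (\<exists>k\<^sub>1 k\<^sub>2. k\<^sub>1 + k\<^sub>2 = k \<and>
            k_pfd G E B ((F - F\<^sub>0) \<inter> arcs (G \<restriction> B)) k\<^sub>1 \<and>
            k_pfd G E C ((F - F\<^sub>0) \<inter> arcs (G \<restriction> C)) k\<^sub>2)"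
  proof -
    \<comment> \<open>The counts add up to \<open>k\<close>, so a side that is one component leaves
      \<open>k - 1\<close> for the other.\<close>
    have "card (side C) = k - 1" if "card (side B) = 1" using card that by simp
    moreover have "card (side B) = k - 1" if "card (side C) = 1" using card that by simp
    ultimately show ?thesis using rec[of B] rec[of C] card by metis
  qed
  ultimately show ?case
    using less.prems two k by (intro k_pfd.intros[of W G F E P k F\<^sub>0 B C]) (auto simp: P_def)
qed

theorem theorem3:
  fixes G :: "('a, 'b) pre_digraph"
    and E :: "nat \<Rightarrow> 'b set"
    and Ebar :: "'b set"
    and p i k :: nat
  assumes "fin_digraph G" and "loopfree_digraph G" and "connected G"
    and "arcs G = (\<Union>j\<in>{1..p}. E j)" and "disjoint_family_on E {1..p}"
    and "i \<in> {1..p}"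
    and "Ebar \<subseteq> E i" and "Ebar \<noteq> {}"
    and "card (pverts (ccg G (verts G) Ebar)) = k" and "2 \<le> k"
  shows "k_pfd G (E i) (verts G) Ebar k \<longleftrightarrow> acyclic (parcs (ccg G (verts G) Ebar))"
proof
  interpret fin_digraph G by fact
  show "acyclic (parcs (ccg G (verts G) Ebar))" if "k_pfd G (E i) (verts G) Ebar k"
    using that by (rule k_pfd_imp_acyclic)
  have "Ebar \<subseteq> arcs G" using assms by blast
  then have "Ebar \<subseteq> arcs (G \<restriction> verts G)" by auto
  moreover have "cut_connected G (arcs G) (verts G)"
    using \<open>connected G\<close> by (simp add: connected_iff_cut_connected)
  ultimately show "k_pfd G (E i) (verts G) Ebar k" if "acyclic (parcs (ccg G (verts G) Ebar))"
    using assms that by (intro acyclic_imp_k_pfd) auto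
qed

end
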